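(* Let $G\subseteq\binom{[n]}{2}$ be a Bernstein-orientable graph. Then for every prime $p$ (and for $p=0$), $G$ is $\mathcal{H}_{n,p}$-independent.
   Context: An alternating closed trail in an oriented graph is a cyclic sequence of distinct arcs $e_0,e_1,\dots,e_{2m}=e_0$ such that (indices mod $2m$) for each $i$ the arcs $e_i$ and $e_{i+1}$ share a vertex $v_i$ and are both directed into $v_i$ or both directed out of $v_i$, and $v_i\neq v_{i+1}$ for each $i$ (non-consecutive $v_i,v_j$ may coincide). An oriented graph is Bernstein if it has no directed cycle and no alternating closed trail; an undirected graph is Bernstein-orientable if it has a Bernstein orientation. For $p$ prime let $K_p=\mathbb{F}_p(r_1,\dots,r_n,b_1,\dots,b_n)$ and for $p=0$ let $K_0=\mathbb{Q}(r_1,\dots,r_n,b_1,\dots,b_n)$, with independent indeterminates $r_i,b_i$. Let $M_n$ be the $\binom{n}{2}\times 2n$ matrix over $K_p$ whose row indexed by $\{i,j\}$, $1\le i<j\le n$, has entries $r_j,b_j,-r_i,-b_i$ in columns $2i-1,2i,2j-1,2j$ respectively and $0$ elsewhere. $\mathcal{H}_{n,p}$ is the row matroid of $M_n$ over $K_p$ (on ground set $\binom{[n]}{2}$); $G$ is $\mathcal{H}_{n,p}$-independent iff the rows indexed by the edges of $G$ are linearly independent over $K_p$. *)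

theory Defs
  imports
    "HOL-Library.Ramsey"
    "HOL-Library.Poly_Mapping"
    "HOL-Computational_Algebra.Fraction_Field"
    "Berlekamp_Zassenhaus.Finite_Field"
begin

section \<open>Bernstein orientations\<close>

text \<open>An oriented graph is given by its arc set, which contains no loops and no pair of
  opposite arcs; the arc \<open>(u, v)\<close> is directed from \<open>u\<close> to \<open>v\<close>.\<close>

definition oriented_graph :: "('v \<times> 'v) set \<Rightarrow> bool" where
  "oriented_graph A \<longleftrightarrow> asym A"

definition orientation_of :: "('v \<times> 'v) set \<Rightarrow> 'v set set \<Rightarrow> bool" where
  "orientation_of A G \<longleftrightarrow> oriented_graph A \<and> (\<lambda>(u, v). {u, v}) ` A = G"

text \<open>The list \<open>es\<close> holds the \<open>2 * m\<close> arcs of the trail, each listed once; indices are cyclic.\<close>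

definition alternating_closed_trail :: "('v \<times> 'v) set \<Rightarrow> ('v \<times> 'v) list \<Rightarrow> bool" where
  "alternating_closed_trail A es \<longleftrightarrow>
     set es \<subseteq> A \<and> distinct es \<and>
     (\<exists>m v. m \<ge> 1 \<and> length es = 2 * m \<and>
        (\<forall>i < 2 * m.
           (snd (es ! i) = v i \<and> snd (es ! ((i + 1) mod (2 * m))) = v i \<or>
            fst (es ! i) = v i \<and> fst (es ! ((i + 1) mod (2 * m))) = v i) \<and>
           v i \<noteq> v ((i + 1) mod (2 * m))))"

definition bernstein :: "('v \<times> 'v) set \<Rightarrow> bool" where
  "bernstein A \<longleftrightarrow> oriented_graph A \<and> acyclic A \<and> (\<nexists>es. alternating_closed_trail A es)"

definition bernstein_orientable :: "'v set set \<Rightarrow> bool" where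
  "bernstein_orientable G \<longleftrightarrow> (\<exists>A. orientation_of A G \<and> bernstein A)"


section \<open>The hyperconnectivity matroid\<close>

text \<open>Rational functions over a field \<open>'k\<close> in indeterminates indexed by \<open>nat\<close>. A polynomial
  maps monomials to coefficients, and a monomial maps indeterminates to exponents.\<close>

type_synonym 'k polyfun = "(nat \<Rightarrow>\<^sub>0 nat) \<Rightarrow>\<^sub>0 'k"

type_synonym 'k ratfun = "'k polyfun fract"

definition poly_vars :: "'k::zero polyfun \<Rightarrow> nat set" where
  "poly_vars f = (\<Union>m \<in> Poly_Mapping.keys f. Poly_Mapping.keys m)"

definition indet :: "nat \<Rightarrow> 'k::field ratfun" where
  "indet i = Fract (Poly_Mapping.single (Poly_Mapping.single i 1) 1) 1"

text \<open>The indeterminates are numbered like the columns of the matrix: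
  \<open>r_i\<close> has number \<open>2 * i - 1\<close> and \<open>b_i\<close> has number \<open>2 * i\<close>, for \<open>i \<ge> 1\<close>.\<close>

definition r_var :: "nat \<Rightarrow> 'k::field ratfun" where
  "r_var i = indet (2 * i - 1)"

definition b_var :: "nat \<Rightarrow> 'k::field ratfun" where
  "b_var i = indet (2 * i)"

text \<open>The field \<open>'k(r_1, ..., r_n, b_1, ..., b_n)\<close> as a subfield of all rational functions.\<close>

definition ratfun_field :: "nat \<Rightarrow> 'k::field ratfun set" where
  "ratfun_field n =
     {Fract f g | f g. g \<noteq> 0 \<and> poly_vars f \<subseteq> {1..2 * n} \<and> poly_vars g \<subseteq> {1..2 * n}}"

text \<open>The entry of the matrix in row \<open>e = {i, j}\<close> with \<open>i < j\<close>, and column \<open>k\<close>, \<open>1 \<le> k \<le> 2 * n\<close>.\<close>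

definition hyper_matrix :: "nat set \<Rightarrow> nat \<Rightarrow> 'k::field ratfun" where
  "hyper_matrix e k =
     (let i = Min e; j = Max e in
      if k = 2 * i - 1 then r_var j
      else if k = 2 * i then b_var j
      else if k = 2 * j - 1 then - r_var i
      else if k = 2 * j then - b_var i
      else 0)"

text \<open>Linear independence of the family of rows indexed by \<open>G\<close>, with base field \<open>'k\<close>. The
  coefficients range over \<open>'k(r_1, ..., r_n, b_1, ..., b_n)\<close>. Characteristic \<open>0\<close> is \<open>'k = rat\<close>;
  a prime \<open>p\<close> is \<open>'k = 'p mod_ring\<close> for a type \<open>'p\<close> with \<open>p\<close> elements.\<close>

definition H_independent :: "'k::field itself \<Rightarrow> nat \<Rightarrow> nat set set \<Rightarrow> bool" where
  "H_independent _ n G \<longleftrightarrow>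
     G \<subseteq> nsets {1..n} 2 \<and>
     (\<forall>c :: nat set \<Rightarrow> 'k ratfun.
        (\<forall>e \<in> G. c e \<in> ratfun_field n) \<longrightarrow>
        (\<forall>k \<in> {1..2 * n}. (\<Sum>e \<in> G. c e * hyper_matrix e k) = 0) \<longrightarrow>
        (\<forall>e \<in> G. c e = 0))"

end

theory Submission
  imports Defs "HOL-Computational_Algebra.Polynomial_Factorial"
begin

text \<open>Let \<open>\<pi>\<close> be a topological ranking of the vertices for a Bernstein orientation, and give
  \<open>b_i\<close> weight \<open>\<pi> i\<close> and \<open>r_i\<close> weight \<open>0\<close>. In a nontrivial relation with polynomial
  coefficients \<open>c\<close>, let \<open>S\<close> be the set of arcs \<open>i \<rightarrow> j\<close> for which the weighted degree of
  \<open>c_ij b_j\<close> is maximal. Split every vertex into a tail copy and a head copy: the absence of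
  alternating closed trails says that the resulting bipartite graph is a forest. Hence some
  \<open>i \<rightarrow> j\<close> in \<open>S\<close> is the only arc of \<open>S\<close> with tail \<open>i\<close>, or the only one with head \<open>j\<close>. In the
  first case its term \<open>c_ij b_j\<close> strictly dominates all others in the second column of vertex
  \<open>i\<close>, in the second case \<open>c_ij r_i\<close> dominates in the first column of vertex \<open>j\<close>; either way
  the column sum cannot vanish.\<close>

section \<open>Acyclic and Bernstein orientations\<close>

text \<open>Rank a vertex by its number of ancestors. Along an arc the ancestor set grows strictly:
  it gains \<open>u\<close>, which by acyclicity is not its own ancestor.\<close>

lemma acyclic_rank:
  fixes A :: "('v \<times> 'v) set"
  assumes "finite A" "acyclic A"
  obtains \<pi> :: "'v \<Rightarrow> nat" where "\<And>u v. (u, v) \<in> A \<Longrightarrow> \<pi> u < \<pi> v"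
proof
  fix u v assume uv: "(u, v) \<in> A"
  have fin: "finite {x. (x, v) \<in> A\<^sup>+}"
    by (rule finite_subset[of _ "Domain A"])
      (use assms(1) in \<open>auto simp: finite_Domain trancl_domain dest: tranclD\<close>)
  have "{x. (x, u) \<in> A\<^sup>+} \<subset> {x. (x, v) \<in> A\<^sup>+}"
    using uv assms(2) by (auto simp: acyclic_def intro: trancl_into_trancl)
  then show "card {x. (x, u) \<in> A\<^sup>+} < card {x. (x, v) \<in> A\<^sup>+}"
    using fin by (rule psubset_card_mono[rotated])
qed

text \<open>Walk through \<open>S\<close>, passing alternately to another arc with the same tail and
  to another with the same head. By finiteness a vertex recurs in the same role, and a shortest such
  return uses no arc twice.\<close>

lemma alternating_closed_trail_exists:
  fixes S :: "('a \<times> 'a) set"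
  assumes "finite S" "S \<noteq> {}" and irr: "\<And>a. a \<in> S \<Longrightarrow> fst a \<noteq> snd a"
    and tail: "\<And>a. a \<in> S \<Longrightarrow> \<exists>b\<in>S. b \<noteq> a \<and> fst b = fst a"
    and head: "\<And>a. a \<in> S \<Longrightarrow> \<exists>b\<in>S. b \<noteq> a \<and> snd b = snd a"
  shows "\<exists>es. alternating_closed_trail S es"
proof -
  \<comment> \<open>The arcs \<open>e k\<close> and \<open>e (Suc k)\<close> of the walk will meet
    at their tails for even \<open>k\<close> and at their heads for odd \<open>k\<close>.\<close>
  define p where "p k = (if even k then fst else snd :: 'a \<times> 'a \<Rightarrow> 'a)" for k :: nat
  have "\<exists>b. b \<in> S \<and> b \<noteq> a \<and> p k b = p k a" if "a \<in> S" for a k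
    using tail[OF that] head[OF that] by (auto simp: p_def)
  moreover obtain a0 where "a0 \<in> S" using \<open>S \<noteq> {}\<close> by auto
  ultimately obtain e where "\<forall>k. e k \<in> S \<and> e (Suc k) \<noteq> e k \<and> p k (e (Suc k)) = p k (e k)"
    using dependent_nat_choice[of "\<lambda>k a. a \<in> S" "\<lambda>k a b. b \<noteq> a \<and> p k b = p k a"] by metis
  then have eS: "e k \<in> S" and ne: "e (Suc k) \<noteq> e k" and pe: "p k (e (Suc k)) = p k (e k)" for k
    by auto
  define x where "x k = p k (e k)" for k
  have x_Suc: "x (Suc k) \<noteq> x k" for k
    using irr[OF eS[of "Suc k"]] pe[of k] by (auto simp: x_def p_def)
  \<comment> \<open>Evenness of \<open>d\<close> makes both visits to the vertex of the same kind,
    tail or head.\<close>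
  define P where "P d \<longleftrightarrow> d > 0 \<and> even d \<and> (\<exists>i. x i = x (i + d))" for d
  have "\<exists>d. P d"
  proof -
    have "range (\<lambda>k. x (2 * k)) \<subseteq> fst ` S"
      using eS by (auto simp: x_def p_def)
    then have "\<not> inj (\<lambda>k. x (2 * k))"
      using \<open>finite S\<close> by (meson finite_imageI finite_imageD finite_subset infinite_UNIV_nat)
    then obtain i j where "i < j" "x (2 * i) = x (2 * j)"
      unfolding inj_def by (metis linorder_neqE_nat)
    then have "P (2 * (j - i))"
      unfolding P_def by (intro conjI exI[of _ "2 * i"]) (auto simp flip: distrib_left)
    then show ?thesis ..
  qed
  define d where "d = (LEAST d. P d)"
  have "P d" unfolding d_def using \<open>\<exists>d. P d\<close> by (rule LeastI_ex)
  then obtain i where d: "d > 0" "even d" and xi: "x i = x (i + d)" by (auto simp: P_def)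
  have min: False if "k < l" "l < k + d" "even (l - k)" "x k = x l" for k l
  proof -
    have "P (l - k)" using that by (auto simp: P_def intro!: exI[of _ k])
    moreover have "l - k < d" using that by linarith
    ultimately show False using not_less_Least[of "l - k" P] by (simp add: d_def)
  qed
  have inj: "e a \<noteq> e b" if ab: "a < b" "b < a + d" for a b
  proof
    assume eab: "e a = e b"
    show False
    proof (cases "even (b - a)")
      case True
      then have "x a = x b" using eab ab by (auto simp: x_def p_def)
      then show False using min ab True by blast
    next
      case False
      \<comment> \<open>For an odd gap, the meeting point just before \<open>e b\<close>, at index
        \<open>c\<close>, already repeats \<open>x a\<close>. Minimality leaves only
        \<open>c = a\<close>, which contradicts \<open>ne\<close>.\<close>
      obtain c where b: "b = Suc c" using ab by (cases b) auto
      have ca: "even (c - a)" "even c = even a" using False ab b by (auto simp: Suc_diff_le)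
      have "x c = x a"
        using eab pe[of c] ca unfolding b x_def p_def by simp
      then show False
        using min[of a c] ab ca ne[of c] eab by (cases "c = a") (auto simp: b)
    qed
  qed
  obtain m where m: "d = 2 * m" using d(2) by blast
  \<comment> \<open>The list starts at \<open>Suc i\<close>: it closes up because
    \<open>e (i + d)\<close> and \<open>e (Suc i)\<close> meet at \<open>x i = x (i + d)\<close>,
    whereas \<open>e i\<close> and \<open>e (i + d)\<close> may differ.\<close>
  define es where "es = map (\<lambda>k. e (Suc i + k)) [0..<d]"
  define v where "v k = x (Suc i + k)" for k
  have len: "length es = 2 * m" by (simp add: es_def m)
  have nth: "es ! k = e (Suc i + k)" if "k < d" for k using that by (simp add: es_def)
  have "inj_on (\<lambda>k. e (Suc i + k)) {0..<d}"
  proof (rule inj_onI, rule ccontr)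
    fix k l assume "k \<in> {0..<d}" "l \<in> {0..<d}" "e (Suc i + k) = e (Suc i + l)" "k \<noteq> l"
    then show False
      using inj[of "Suc i + k" "Suc i + l"] inj[of "Suc i + l" "Suc i + k"]
      by (cases k l rule: linorder_cases) auto
  qed
  then have "distinct es" by (simp add: es_def distinct_map)
  have step: "(snd (es ! k) = v k \<and> snd (es ! ((k + 1) mod d)) = v k \<or>
      fst (es ! k) = v k \<and> fst (es ! ((k + 1) mod d)) = v k) \<and> v k \<noteq> v ((k + 1) mod d)"
    if k: "k < d" for k
  proof (cases "Suc k = d")
    case True
    have "p (i + d) (e (Suc i)) = p (i + d) (e (i + d))"
      using xi pe[of i] d(2) by (simp add: x_def p_def)
    moreover have "Suc i + k = i + d" using True by simp
    moreover have "x (Suc i) \<noteq> x (i + d)" using x_Suc[of i] xi by simp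
    ultimately show ?thesis
      using True k d by (auto simp: nth v_def x_def p_def split: if_splits)
  next
    case False
    then have "Suc k < d" using k by simp
    then show ?thesis
      using pe[of "Suc i + k"] x_Suc[of "Suc i + k"] k
      by (auto simp: nth v_def x_def p_def split: if_splits)
  qed
  have "alternating_closed_trail S es"
    unfolding alternating_closed_trail_def
  proof (intro conjI exI[of _ m] exI[of _ v])
    show "set es \<subseteq> S" using eS by (auto simp: es_def)
    show "distinct es" by fact
    show "1 \<le> m" using d m by simp
    show "length es = 2 * m" by (rule len)
  qed (use step m in blast)
  then show ?thesis ..
qed

text \<open>A trail inside \<open>S\<close> is one inside \<open>A\<close>, so some arc of
  \<open>S\<close> has no partner at its tail or none at its head. The two cases are the two sides
  on which the split graph can have a leaf.\<close>

lemma bernstein_leaf: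
  assumes "bernstein A" "finite S" "S \<subseteq> A" "S \<noteq> {}"
  obtains a where "a \<in> S" "\<And>b. b \<in> S \<Longrightarrow> fst b = fst a \<Longrightarrow> b = a"
  | a where "a \<in> S" "\<And>b. b \<in> S \<Longrightarrow> snd b = snd a \<Longrightarrow> b = a"
proof -
  have irr: "fst a \<noteq> snd a" if "a \<in> S" for a
    using assms(1,3) that unfolding bernstein_def acyclic_def
    by (metis prod.collapse r_into_trancl' subsetD)
  have "\<not> alternating_closed_trail S es" for es
    using assms(1,3) unfolding bernstein_def alternating_closed_trail_def by (meson order_trans)
  then show thesis
    using alternating_closed_trail_exists[OF assms(2,4) irr] that by metis
qed

section \<open>Weighted degrees\<close>

definition weight :: "(nat \<Rightarrow> nat) \<Rightarrow> (nat \<Rightarrow>\<^sub>0 nat) \<Rightarrow> nat" where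
  "weight w m = (\<Sum>k\<in>Poly_Mapping.keys m. Poly_Mapping.lookup m k * w k)"

lemma weight_add_single: "weight w (m + Poly_Mapping.single x 1) = weight w m + w x"
proof -
  let ?K = "insert x (Poly_Mapping.keys m)"
  have eq: "weight w q = (\<Sum>k\<in>?K. Poly_Mapping.lookup q k * w k)"
    if "Poly_Mapping.keys q \<subseteq> ?K" for q
    unfolding weight_def using that by (intro sum.mono_neutral_left) (auto simp: in_keys_iff)
  have "Poly_Mapping.keys (m + Poly_Mapping.single x 1) \<subseteq> ?K"
    using Poly_Mapping.keys_add[of m "Poly_Mapping.single x 1"] by auto
  then have "weight w (m + Poly_Mapping.single x 1)
      = weight w m + (\<Sum>k\<in>?K. Poly_Mapping.lookup (Poly_Mapping.single x (1::nat)) k * w k)"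
    using eq[of "m + Poly_Mapping.single x 1"] eq[of m]
    by (simp only: lookup_add distrib_right sum.distrib subset_insertI)
  also have "(\<Sum>k\<in>?K. Poly_Mapping.lookup (Poly_Mapping.single x (1::nat)) k * w k)
      = (\<Sum>k\<in>?K. if k = x then w x else 0)"
    by (intro sum.cong) (auto simp: lookup_single)
  also have "\<dots> = w x" by simp
  finally show ?thesis .
qed

text \<open>By cancellation, only the exponent \<open>m\<close> of \<open>f\<close> contributes to
  \<open>m + x\<close>.\<close>

lemma lookup_mult_single:
  fixes f :: "'a::cancel_comm_monoid_add \<Rightarrow>\<^sub>0 'b::comm_semiring_1"
  shows "Poly_Mapping.lookup (f * Poly_Mapping.single x s) (m + x) = Poly_Mapping.lookup f m * s"
proof -
  have "(\<Sum>q. Poly_Mapping.lookup (Poly_Mapping.single x s) q when m + x = a + q)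
      = (s when a = m)" for a
  proof -
    have "(Poly_Mapping.lookup (Poly_Mapping.single x s) q when m + x = a + q)
        = ((s when a = m) when q = x)" for q
      by (auto simp: lookup_single when_def)
    then show ?thesis by simp
  qed
  then show ?thesis by (simp add: lookup_mult mult_when)
qed

text \<open>The monomial \<open>m\<close> times the variable \<open>x e\<close> survives: all other
  products have only monomials of smaller weight, so nothing cancels it.\<close>

lemma sum_mult_single_nonzero:
  fixes f :: "'a \<Rightarrow> 'k::field polyfun"
  assumes "finite E" "e \<in> E" and m: "m \<in> Poly_Mapping.keys (f e)" and s: "s e \<noteq> 0"
    and dom: "\<And>a q. a \<in> E \<Longrightarrow> a \<noteq> e \<Longrightarrow> q \<in> Poly_Mapping.keys (f a) \<Longrightarrow>
      weight w q + w (x a) < weight w m + w (x e)"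
  shows "(\<Sum>a\<in>E. f a * Poly_Mapping.single (Poly_Mapping.single (x a) 1) (s a)) \<noteq> 0"
proof -
  let ?t = "\<lambda>a. f a * Poly_Mapping.single (Poly_Mapping.single (x a) 1) (s a)"
  let ?M = "m + Poly_Mapping.single (x e) 1"
  have "Poly_Mapping.lookup (?t a) ?M = 0" if a: "a \<in> E - {e}" for a
  proof (rule ccontr)
    assume "Poly_Mapping.lookup (?t a) ?M \<noteq> 0"
    then have "?M \<in> Poly_Mapping.keys (?t a)" by (simp add: in_keys_iff)
    then obtain q where "q \<in> Poly_Mapping.keys (f a)" "?M = q + Poly_Mapping.single (x a) 1"
      using keys_mult[of "f a"] by (fastforce split: if_splits)
    then show False
      using dom[of a q] a weight_add_single[of w m "x e"] weight_add_single[of w q "x a"] by auto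
  qed
  then have "(\<Sum>a\<in>E - {e}. Poly_Mapping.lookup (?t a) ?M) = 0" by (intro sum.neutral) blast
  then have "Poly_Mapping.lookup (\<Sum>a\<in>E. ?t a) ?M = Poly_Mapping.lookup (?t e) ?M"
    using sum.remove[OF assms(1,2), of "\<lambda>a. Poly_Mapping.lookup (?t a) ?M"]
    by (simp only: lookup_sum add_0_right)
  also have "\<dots> \<noteq> 0" using m s by (simp only: lookup_mult_single) (simp add: in_keys_iff)
  finally show ?thesis by auto
qed

section \<open>The matrix and its columns\<close>

text \<open>Serves to replace the coefficients of a linear relation by polynomials, whose monomials
  can be weighed.\<close>

lemma common_denominator:
  fixes c :: "'a \<Rightarrow> 'r::idom fract"
  assumes "finite A"
  obtains d f where "d \<noteq> 0" "\<And>a. a \<in> A \<Longrightarrow> c a * to_fract d = to_fract (f a)"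
proof -
  have "\<exists>d. d \<noteq> 0 \<and> (\<forall>a\<in>A. \<exists>p. c a * to_fract d = to_fract p)"
    using assms
  proof induction
    case empty
    show ?case by (intro exI[of _ 1]) simp
  next
    case (insert a A)
    then obtain d where d: "d \<noteq> 0" "\<forall>a\<in>A. \<exists>p. c a * to_fract d = to_fract p" by auto
    obtain p q where pq: "c a = Fract p q" "q \<noteq> 0" by (cases "c a") auto
    have "c a * to_fract (d * q) = to_fract (p * d)"
      using pq by (simp add: to_fract_def eq_fract)
    moreover have "\<exists>r. c b * to_fract (d * q) = to_fract r" if "b \<in> A" for b
      using d(2) that by (metis mult.assoc to_fract_mult)
    ultimately show ?case using d(1) pq(2) by (intro exI[of _ "d * q"]) (auto simp del: to_fract_mult)
  qed
  then show thesis using that by metis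
qed

text \<open>\<open>t = 1\<close> selects the first column of a vertex and the variables \<open>r\<close>, \<open>t = 0\<close> its second
  column and the variables \<open>b\<close>.\<close>

lemma hyper_matrix_incident:
  assumes "u \<ge> 1" "v \<ge> 1" "u \<noteq> v" "t \<le> 1"
  shows "hyper_matrix {u, v} (2 * u - t) =
    to_fract (Poly_Mapping.single (Poly_Mapping.single (2 * v - t) 1)
      (if u < v then 1 else - 1 :: 'k::field))"
proof -
  have "t = 0 \<or> t = 1" using assms(4) by auto
  \<comment> \<open>Writing the vertices as successors removes the truncated subtraction in
    \<open>2 * u - 1\<close>.\<close>
  moreover obtain u' v' where "u = Suc u'" "v = Suc v'"
    using assms(1,2) by (cases u; cases v) auto
  ultimately show ?thesis
    using assms(3) by (cases "u' < v'")
      (auto simp: hyper_matrix_def Let_def r_var_def b_var_def indet_def to_fract_def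
        min_def max_def single_uminus Suc_double_not_eq_double double_not_eq_Suc_double)
qed

lemma hyper_matrix_not_incident:
  assumes "u \<ge> 1" "v \<ge> 1" "z \<ge> 1" "z \<noteq> u" "z \<noteq> v" "t \<le> 1"
  shows "hyper_matrix {u, v} (2 * z - t) = 0"
proof -
  have "t = 0 \<or> t = 1" using assms(6) by auto
  moreover obtain u' v' z' where "u = Suc u'" "v = Suc v'" "z = Suc z'"
    using assms(1-3) by (cases u; cases v; cases z) auto
  ultimately show ?thesis
    using assms(4,5)
    by (auto simp: hyper_matrix_def Let_def min_def max_def
        Suc_double_not_eq_double double_not_eq_Suc_double)
qed

lemma H_independent_if_bernstein_orientable:
  assumes G: "G \<subseteq> nsets {1..n} 2" and "bernstein_orientable G"
  shows "H_independent TYPE('k::field) n G"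
  unfolding H_independent_def
proof (intro conjI allI impI ballI)
  fix c :: "nat set \<Rightarrow> 'k ratfun" and e0
  assume rel: "\<forall>k\<in>{1..2 * n}. (\<Sum>e\<in>G. c e * hyper_matrix e k) = 0" and e0: "e0 \<in> G"
  obtain A where A: "orientation_of A G" "bernstein A"
    using assms(2) unfolding bernstein_orientable_def by blast
  define ed where "ed a = {fst a, snd a}" for a :: "nat \<times> nat"
  have AG: "ed ` A = G" and asym: "asym A"
    using A(1) by (auto simp: orientation_of_def oriented_graph_def ed_def case_prod_unfold)
  have inj: "inj_on ed A"
    using asym by (auto simp: inj_on_def ed_def doubleton_eq_iff dest: asymD)
  have "finite G" using G by (rule finite_subset) (simp add: finite_imp_finite_nsets)
  then have finA: "finite A" using AG inj finite_imageD by blast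
  have vert: "fst a \<in> {1..n}" "snd a \<in> {1..n}" "fst a \<noteq> snd a" if "a \<in> A" for a
  proof -
    have "ed a \<in> nsets {1..n} 2" using G AG that by blast
    then show "fst a \<in> {1..n}" "snd a \<in> {1..n}" "fst a \<noteq> snd a"
      by (auto simp: nsets_def ed_def)
  qed
  obtain \<pi> :: "nat \<Rightarrow> nat" where \<pi>: "\<And>u v. (u, v) \<in> A \<Longrightarrow> \<pi> u < \<pi> v"
    using acyclic_rank finA A(2) unfolding bernstein_def by metis
  obtain d f where d: "d \<noteq> 0" and f: "\<And>a. a \<in> A \<Longrightarrow> c (ed a) * to_fract d = to_fract (f a)"
    using common_denominator[OF finA, of "\<lambda>a. c (ed a)"] by metis
  define E where "E z = {a \<in> A. z = fst a \<or> z = snd a}" for z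
  define oth where "oth z a = (if z = fst a then snd a else fst a)" for z :: nat and a :: "nat \<times> nat"
  \<comment> \<open>The sign of the entry in the row of \<open>a\<close> and either column of
    \<open>z\<close>: a row is negative at its larger endpoint.\<close>
  define s :: "nat \<Rightarrow> nat \<times> nat \<Rightarrow> 'k" where "s z a = (if z < oth z a then 1 else - 1)" for z a
  \<comment> \<open>Both columns of \<open>z\<close> in the relation, multiplied by \<open>d\<close>
    and read as polynomial identities.\<close>
  have col: "(\<Sum>a\<in>E z. f a * Poly_Mapping.single (Poly_Mapping.single (2 * oth z a - t) 1) (s z a)) = 0"
    if z: "z \<in> {1..n}" and t: "t \<le> 1" for z t
  proof -
    let ?h = "\<lambda>a. Poly_Mapping.single (Poly_Mapping.single (2 * oth z a - t) 1) (s z a)"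
    have inc: "hyper_matrix (ed a) (2 * z - t) = to_fract (?h a)" if "a \<in> E z" for a
    proof -
      have "ed a = {z, oth z a}" "oth z a \<ge> 1" "oth z a \<noteq> z"
        using that vert[of a] by (auto simp: E_def ed_def oth_def)
      then show ?thesis
        using hyper_matrix_incident[of z "oth z a" t] z t by (simp add: s_def)
    qed
    have "to_fract (\<Sum>a\<in>E z. f a * ?h a) = (\<Sum>a\<in>E z. to_fract (f a * ?h a))"
      by (induction "E z" rule: infinite_finite_induct) auto
    also have "\<dots> = (\<Sum>a\<in>E z. to_fract d * (c (ed a) * hyper_matrix (ed a) (2 * z - t)))"
    proof (intro sum.cong refl)
      fix a assume a: "a \<in> E z"
      then have "a \<in> A" by (simp add: E_def)
      then show "to_fract (f a * ?h a) = to_fract d * (c (ed a) * hyper_matrix (ed a) (2 * z - t))"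
        unfolding to_fract_mult inc[OF a] f[OF \<open>a \<in> A\<close>, symmetric]
        by (simp only: mult.assoc mult.left_commute)
    qed
    also have "\<dots> = (\<Sum>a\<in>A. to_fract d * (c (ed a) * hyper_matrix (ed a) (2 * z - t)))"
    proof (intro sum.mono_neutral_left ballI)
      fix a assume "a \<in> A - E z"
      then have "hyper_matrix (ed a) (2 * z - t) = (0 :: 'k ratfun)"
        using hyper_matrix_not_incident[of "fst a" "snd a" z t] vert[of a] z t
        by (auto simp: E_def ed_def)
      then show "to_fract d * (c (ed a) * hyper_matrix (ed a) (2 * z - t)) = 0" by simp
    qed (use finA in \<open>auto simp: E_def\<close>)
    also have "\<dots> = to_fract d * (\<Sum>e\<in>G. c e * hyper_matrix e (2 * z - t))"
      unfolding AG[symmetric] sum.reindex[OF inj] by (simp add: sum_distrib_left)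
    also have "(\<Sum>e\<in>G. c e * hyper_matrix e (2 * z - t)) = 0"
    proof -
      have "2 * z - t \<in> {1..2 * n}" using z t by auto
      then show ?thesis using rel by blast
    qed
    finally show ?thesis by (simp only: mult_zero_right to_fract_eq_0_iff)
  qed
  \<comment> \<open>Even numbers \<open>2 * i\<close> belong to \<open>b_i\<close>, odd ones to the
    \<open>r_i\<close>.\<close>
  define w where "w k = (if even k then \<pi> (k div 2) else 0)" for k
  define X where "X = (SIGMA a:A. Poly_Mapping.keys (f a))"
  \<comment> \<open>\<open>D\<close> is meaningful only for nonempty \<open>X\<close>, which follows
    below from \<open>c e0 \<noteq> 0\<close>.\<close>
  define D where "D = Max ((\<lambda>(a, m). weight w m + \<pi> (snd a)) ` X)"
  define S where "S = {a \<in> A. \<exists>m\<in>Poly_Mapping.keys (f a). weight w m + \<pi> (snd a) = D}"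
  have finX: "finite X" unfolding X_def using finA by (intro finite_SigmaI) auto
  have le: "weight w m + \<pi> (snd a) \<le> D" if "a \<in> A" "m \<in> Poly_Mapping.keys (f a)" for a m
    unfolding D_def using that finX by (intro Max_ge) (force simp: X_def)+
  then have less: "weight w m + \<pi> (snd a) < D"
    if "a \<in> A" "a \<notin> S" "m \<in> Poly_Mapping.keys (f a)" for a m
    using le[OF that(1,3)] that by (auto simp: S_def less_le)
  have E: "finite (E z)" for z using finA by (simp add: E_def)
  show "c e0 = 0"
  proof (rule ccontr)
    assume "c e0 \<noteq> 0"
    obtain a0 where a0: "a0 \<in> A" "e0 = ed a0" using AG e0 by auto
    have "f a0 \<noteq> 0" using f[OF a0(1)] \<open>c e0 \<noteq> 0\<close> d a0(2) by auto
    then obtain m0 where "m0 \<in> Poly_Mapping.keys (f a0)"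
      by (metis all_not_in_conv keys_eq_empty)
    then have "X \<noteq> {}" using a0(1) by (auto simp: X_def)
    then have "D \<in> (\<lambda>(a, m). weight w m + \<pi> (snd a)) ` X"
      unfolding D_def using finX by (intro Max_in) auto
    then have S: "S \<noteq> {}" by (force simp: S_def X_def)
    have "finite S" "S \<subseteq> A" using finA by (auto simp: S_def)
    then show False
    proof (rule bernstein_leaf[OF A(2) _ _ S])
      fix a assume aS: "a \<in> S" and uniq: "\<And>b. b \<in> S \<Longrightarrow> fst b = fst a \<Longrightarrow> b = a"
      obtain m where m: "m \<in> Poly_Mapping.keys (f a)" "weight w m + \<pi> (snd a) = D"
        and aA: "a \<in> A" using aS by (auto simp: S_def)
      \<comment> \<open>An arc \<open>b\<close> with the same tail lies outside \<open>S\<close>. An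
        arc \<open>b\<close> entering that vertex contributes the variable of \<open>fst b\<close>,
        of smaller rank than \<open>snd b\<close>, and so stays below \<open>D\<close>.\<close>
      have "weight w q + w (2 * oth (fst a) b - 0) < weight w m + w (2 * oth (fst a) a - 0)"
        if b: "b \<in> E (fst a)" "b \<noteq> a" "q \<in> Poly_Mapping.keys (f b)" for b q
      proof (cases "fst b = fst a")
        case True
        then have "b \<notin> S" using uniq b(2) by blast
        then show ?thesis
          using less[of b q] b m(2) True by (simp add: E_def w_def oth_def)
      next
        case False
        then show ?thesis
          using le[of b q] \<pi>[of "fst b" "snd b"] b m(2) by (auto simp: E_def w_def oth_def)
      qed
      then have "(\<Sum>b\<in>E (fst a). f b *
          Poly_Mapping.single (Poly_Mapping.single (2 * oth (fst a) b - 0) 1) (s (fst a) b)) \<noteq> 0"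
        using m(1) aA E by (intro sum_mult_single_nonzero[where w = w]) (auto simp: E_def s_def)
      then show False using col[of "fst a" 0] vert[OF aA] by simp
    next
      fix a assume aS: "a \<in> S" and uniq: "\<And>b. b \<in> S \<Longrightarrow> snd b = snd a \<Longrightarrow> b = a"
      obtain m where m: "m \<in> Poly_Mapping.keys (f a)" "weight w m + \<pi> (snd a) = D"
        and aA: "a \<in> A" using aS by (auto simp: S_def)
      have w0: "w (2 * oth (snd a) b - 1) = 0" if "b \<in> A" for b
        using vert[OF that] by (auto simp: w_def oth_def)
      \<comment> \<open>For an equal head, cancel its rank in the strict bound. An arc
        \<open>b\<close> leaving that vertex has \<open>\<pi> (snd b) > \<pi> (snd a)\<close>, which
        forces \<open>weight w q < weight w m\<close>.\<close>
      have "weight w q + w (2 * oth (snd a) b - 1) < weight w m + w (2 * oth (snd a) a - 1)"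
        if b: "b \<in> E (snd a)" "b \<noteq> a" "q \<in> Poly_Mapping.keys (f b)" for b q
      proof (cases "snd b = snd a")
        case True
        then have "b \<notin> S" using uniq b(2) by blast
        then show ?thesis
          using less[of b q] b m(2) True w0[of b] w0[OF aA] by (simp add: E_def)
      next
        case False
        then show ?thesis
          using le[of b q] \<pi>[of "fst b" "snd b"] b m(2) w0[of b] w0[OF aA]
          by (auto simp: E_def)
      qed
      then have "(\<Sum>b\<in>E (snd a). f b *
          Poly_Mapping.single (Poly_Mapping.single (2 * oth (snd a) b - 1) 1) (s (snd a) b)) \<noteq> 0"
        using m(1) aA E by (intro sum_mult_single_nonzero[where w = w]) (auto simp: E_def s_def)
      then show False using col[of "snd a" 1] vert[OF aA] by simp
    qed
  qed
qed (use G in blast)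

theorem theorem1p12:
  fixes n :: nat and G :: "nat set set"
  assumes "G \<subseteq> nsets {1..n} 2"
    and "bernstein_orientable G"
  shows "H_independent TYPE('p::prime_card mod_ring) n G \<and> H_independent TYPE(rat) n G"
  by (intro conjI H_independent_if_bernstein_orientable assms)

end
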